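(* Let $X, Y, \sigma, \omega, f_1,\dots,f_r$ and real numbers $\xi_1,\dots,\xi_m$ be as in the context (so that every integral $\int_\sigma f_1^{n_1}\cdots f_r^{n_r}\,\omega$ with integers $n_i\ge 0$ lies in $\mathbb{Q}\xi_1+\cdots+\mathbb{Q}\xi_m$). Suppose that either $m=2$, $\xi_1=1$ and $\xi_2=\xi$; or $m>2$, $\xi_1=1$ and $\xi_i\in\mathbb{Q}[\xi]$ for all $i>1$, for some real number $\xi$. Suppose that for arbitrarily large $N$ there exist sequences $\mathfrak{f}_1,\dots,\mathfrak{f}_N$ of linearly independent polynomials in $f_1,\dots,f_r$ such that the matrix $Q^\sigma=\left(\int_\sigma \mathfrak{f}_i\mathfrak{f}_j\,\omega\right)_{1\le i,j\le N}$ has non-zero determinant, together with invertible matrices $D^\ell,D^r\in \mathrm{GL}_N(\mathbb{Q})$ such that all entries of $D^\ell Q^\sigma D^r$ lie in $\mathbb{Z}\xi_1+\cdots+\mathbb{Z}\xi_m$, and such that, writing $\mathcal{M}_N=\bigoplus_{i=1}^N\mathbb{Z}\mathfrak{f}_i$ and $\delta_{\mathcal{M}_N}=|\det(D^\ell D^r)|$, $$ t_{\mathcal{M}_N}(\sigma)^2\,\delta_{\mathcal{M}_N}\longrightarrow 0 $$ as $N\to\infty$ along these values of $N$. Then $\xi$ is irrational.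
   Context: Setting: $X$ is a smooth affine algebraic variety of dimension $d$ over $\mathbb{Q}$; $\omega$ is a regular differential $d$-form on $X$; $Y\subset X$ is a divisor over $\mathbb{Q}$; $\sigma\subset X(\mathbb{C})$ is a (compact) relative $d$-chain whose boundary is contained in $Y(\mathbb{C})$; $f_1,\dots,f_r:X\to\mathbb{A}^1$ are regular functions defined over $\mathbb{Q}$. The integrals $I(n_1,\dots,n_r)=\int_\sigma f_1^{n_1}\cdots f_r^{n_r}\,\omega$ are real for all integers $n_i\ge 0$, and $\xi_1,\dots,\xi_m$ are fixed real numbers (periods) such that $I(n_1,\dots,n_r)\in\mathbb{Q}\xi_1+\cdots+\mathbb{Q}\xi_m$ for all integers $n_i\geq 0$. "Polynomials in $f_1,\dots,f_r$" have rational coefficients and are regarded as regular functions on $X$. For linearly independent $\mathfrak{f}_1,\dots,\mathfrak{f}_N$ with $\mathcal{M}_N=\bigoplus_{i=1}^N\mathbb{Z}\mathfrak{f}_i$, define $$t_{\mathcal{M}_N}(\sigma)=\sup_{z_1,\dots,z_N\in\sigma}\left|\det(\mathfrak{f}_i(z_j))_{1\le i,j\le N}\right|.$$ *)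

theory Defs
  imports
    "HOL-Analysis.Analysis"
    "HOL-Homology.Homology"
    "HOL-Library.Poly_Mapping"
    "HOL-Computational_Algebra.Polynomial"
    "Jordan_Normal_Form.Determinant"
begin

text \<open>The names \<open>det\<close>, \<open>mat\<close> and the symbol \<open>$\<close> exist both in HOL-Analysis and in
  Jordan_Normal_Form. Below, the components of a point of complex affine space are written with
  \<^const>\<open>vec_nth\<close>, and matrices whose size is a natural number are those of Jordan_Normal_Form.\<close>


section \<open>Polynomials over the rationals\<close>

type_synonym 'v qpoly = "('v \<Rightarrow>\<^sub>0 nat) \<Rightarrow>\<^sub>0 rat"

definition qeval :: "'v::finite qpoly \<Rightarrow> ('v \<Rightarrow> complex) \<Rightarrow> complex" where
  "qeval g x = (\<Sum>m\<in>Poly_Mapping.keys g.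
     of_rat (Poly_Mapping.lookup g m) * (\<Prod>v\<in>UNIV. x v ^ Poly_Mapping.lookup m v))"

definition qderiv :: "'v \<Rightarrow> 'v qpoly \<Rightarrow> 'v qpoly" where
  "qderiv v g = (\<Sum>m\<in>Poly_Mapping.keys g.
     Poly_Mapping.single (m - Poly_Mapping.single v 1)
       (of_nat (Poly_Mapping.lookup m v) * Poly_Mapping.lookup g m))"

text \<open>Every regular function over \<open>\<rat>\<close> on a closed subvariety of affine space is the restriction
  of a polynomial function.\<close>

definition regfun :: "'n::finite qpoly \<Rightarrow> complex ^ 'n \<Rightarrow> complex" where
  "regfun g z = qeval g (vec_nth z)"

text \<open>The regular function \<open>P(f\<^sub>1,\<dots>,f\<^sub>r)\<close>.\<close>

definition poly_in :: "('r::finite \<Rightarrow> 'n::finite qpoly) \<Rightarrow> 'r qpoly \<Rightarrow> complex ^ 'n \<Rightarrow> complex" where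
  "poly_in f P z = qeval P (\<lambda>s. regfun (f s) z)"


section \<open>Affine varieties over the rationals\<close>

text \<open>A reduced closed subscheme of affine space over \<open>\<rat>\<close> is represented by its set of complex
  points, which determines it; these sets are the closed sets of the \<open>\<rat>\<close>-Zariski topology, and
  irreducibility and dimension below are those of the scheme over \<open>\<rat>\<close>.\<close>

definition zero_locus :: "'n::finite qpoly set \<Rightarrow> (complex ^ 'n) set" where
  "zero_locus S = {z. \<forall>g\<in>S. regfun g z = 0}"

definition vanishing_ideal :: "(complex ^ 'n::finite) set \<Rightarrow> 'n qpoly set" where
  "vanishing_ideal X = {g. \<forall>z\<in>X. regfun g z = 0}"

definition Q_closed :: "(complex ^ 'n::finite) set \<Rightarrow> bool" where
  "Q_closed X \<longleftrightarrow> (\<exists>S. X = zero_locus S)"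

definition Q_irreducible :: "(complex ^ 'n::finite) set \<Rightarrow> bool" where
  "Q_irreducible Z \<longleftrightarrow> Q_closed Z \<and> Z \<noteq> {} \<and>
     (\<forall>A B. Q_closed A \<longrightarrow> Q_closed B \<longrightarrow> Z = A \<union> B \<longrightarrow> Z = A \<or> Z = B)"

definition Q_component :: "(complex ^ 'n::finite) set \<Rightarrow> (complex ^ 'n) set \<Rightarrow> bool" where
  "Q_component Z X \<longleftrightarrow> Q_irreducible Z \<and> Z \<subseteq> X \<and>
     (\<forall>W. Q_irreducible W \<longrightarrow> Z \<subseteq> W \<longrightarrow> W \<subseteq> X \<longrightarrow> W = Z)"

definition irreducible_chain :: "(complex ^ 'n::finite) set \<Rightarrow> nat \<Rightarrow> (nat \<Rightarrow> (complex ^ 'n) set) \<Rightarrow> bool" where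
  "irreducible_chain X l Z \<longleftrightarrow>
     (\<forall>i\<le>l. Q_irreducible (Z i) \<and> Z i \<subseteq> X) \<and> (\<forall>i<l. Z i \<subset> Z (Suc i))"

text \<open>\<open>X\<close> has Krull dimension \<open>d\<close>.\<close>

definition has_dimension :: "(complex ^ 'n::finite) set \<Rightarrow> nat \<Rightarrow> bool" where
  "has_dimension X d \<longleftrightarrow>
     (\<exists>Z. irreducible_chain X d Z) \<and> (\<forall>l Z. irreducible_chain X l Z \<longrightarrow> l \<le> d)"

definition tangent_space :: "(complex ^ 'n::finite) set \<Rightarrow> complex ^ 'n \<Rightarrow> (complex ^ 'n) set" where
  "tangent_space X p = {v. \<forall>g\<in>vanishing_ideal X. (\<Sum>i\<in>UNIV. regfun (qderiv i g) p * vec_nth v i) = 0}"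

text \<open>Smoothness is the Jacobian criterion at all complex points. A variety of dimension \<open>d\<close> is
  allowed to be reducible, but all its components have dimension \<open>d\<close>.\<close>

definition smooth_affine_variety :: "(complex ^ 'n::finite) set \<Rightarrow> nat \<Rightarrow> bool" where
  "smooth_affine_variety X d \<longleftrightarrow> Q_closed X \<and> X \<noteq> {} \<and>
     (\<forall>Z. Q_component Z X \<longrightarrow> has_dimension Z d) \<and>
     (\<forall>p\<in>X. vec.dim (tangent_space X p) = d)"

text \<open>A divisor enters only through its support: a closed subset of pure codimension one
  (possibly empty).\<close>

definition divisor_on :: "(complex ^ 'n::finite) set \<Rightarrow> (complex ^ 'n) set \<Rightarrow> nat \<Rightarrow> bool" where
  "divisor_on Y X d \<longleftrightarrow> Q_closed Y \<and> Y \<subseteq> X \<and>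
     (\<forall>Z. Q_component Z Y \<longrightarrow> (\<exists>e. has_dimension Z e \<and> Suc e = d))"


section \<open>Differential forms and integration over singular chains\<close>

text \<open>A regular \<open>d\<close>-form on a closed subvariety of affine space is the restriction of a form
  \<open>\<Sum>\<^sub>J w\<^sub>J dx\<^bsub>J!0\<^esub> \<and> \<dots> \<and> dx\<^bsub>J!(d-1)\<^esub>\<close> with polynomial coefficients, where \<open>J\<close> runs through the lists
  of \<open>d\<close> coordinates. Several families \<open>w\<close> represent the same form on \<open>X\<close>; the integrals over
  chains in \<open>X\<close> do not depend on the choice.\<close>

type_synonym 'n qform = "'n list \<Rightarrow> 'n qpoly"

text \<open>\<open>\<real>\<^sup>d\<close> is the space of extensional functions on \<open>{..<d}\<close>, with the product topology and the
  product measure. The chart maps \<open>(t\<^sub>0,\<dots>,t\<^bsub>d-1\<^esub>)\<close> to the point with barycentric coordinates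
  \<open>(1 - \<Sum>t, t\<^sub>0, \<dots>, t\<^bsub>d-1\<^esub>)\<close> of \<^term>\<open>standard_simplex d\<close>.\<close>

abbreviation Rn_top :: "nat \<Rightarrow> (nat \<Rightarrow> real) topology" where
  "Rn_top d \<equiv> product_topology (\<lambda>_. euclideanreal) {..<d}"

abbreviation Rn_measure :: "nat \<Rightarrow> (nat \<Rightarrow> real) measure" where
  "Rn_measure d \<equiv> Pi\<^sub>M {..<d} (\<lambda>_. lborel)"

definition closed_corner :: "nat \<Rightarrow> (nat \<Rightarrow> real) set" where
  "closed_corner d = {t \<in> extensional {..<d}. (\<forall>i<d. 0 \<le> t i) \<and> (\<Sum>i<d. t i) \<le> 1}"

definition open_corner :: "nat \<Rightarrow> (nat \<Rightarrow> real) set" where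
  "open_corner d = {t \<in> extensional {..<d}. (\<forall>i<d. 0 < t i) \<and> (\<Sum>i<d. t i) < 1}"

definition simplex_chart :: "nat \<Rightarrow> (nat \<Rightarrow> real) \<Rightarrow> nat \<Rightarrow> real" where
  "simplex_chart d t i =
     (case i of 0 \<Rightarrow> 1 - (\<Sum>j<d. t j) | Suc j \<Rightarrow> if j < d then t j else 0)"

text \<open>Continuously differentiable singular simplices: in the chart, \<open>s\<close> extends to a map with
  continuous partial derivatives on an open neighbourhood in \<open>\<real>\<^sup>d\<close>.\<close>

definition C1_singular_simplex :: "nat \<Rightarrow> ((nat \<Rightarrow> real) \<Rightarrow> complex ^ 'n::finite) \<Rightarrow> bool" where
  "C1_singular_simplex d s \<longleftrightarrow>
     (\<exists>U g g'. openin (Rn_top d) U \<and> closed_corner d \<subseteq> U \<and>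
        (\<forall>t\<in>closed_corner d. g t = s (simplex_chart d t)) \<and>
        (\<forall>j<d. (\<forall>t\<in>U. ((\<lambda>x. g (t(j := x))) has_vector_derivative g' j t) (at (t j))) \<and>
               continuous_map (subtopology (Rn_top d) U) (euclidean :: (complex ^ 'n) topology) (g' j)))"

text \<open>Coefficient of the pullback along \<open>s\<close> of the form \<open>w\<close> with respect to
  \<open>dt\<^sub>0 \<and> \<dots> \<and> dt\<^bsub>d-1\<^esub>\<close>, at an interior point \<open>t\<close>.\<close>

definition pullback_coeff ::
  "nat \<Rightarrow> ((nat \<Rightarrow> real) \<Rightarrow> complex ^ 'n::finite) \<Rightarrow> 'n qform \<Rightarrow> (nat \<Rightarrow> real) \<Rightarrow> complex" where
  "pullback_coeff d s w t =
     (\<Sum>J | length J = d. regfun (w J) (s (simplex_chart d t)) *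
        Determinant.det (Matrix.mat d d (\<lambda>(a, b).
          vector_derivative (\<lambda>x. vec_nth (s (simplex_chart d (t(b := x)))) (J ! a)) (at (t b)))))"

text \<open>The integral of \<open>h \<omega>\<close> over a singular simplex and over a singular chain, for a function \<open>h\<close>
  and the form \<open>\<omega>\<close> represented by \<open>w\<close>. The boundary of the simplex is a null set and is left out.\<close>

definition simplex_integral ::
  "nat \<Rightarrow> ((nat \<Rightarrow> real) \<Rightarrow> complex ^ 'n::finite) \<Rightarrow> (complex ^ 'n \<Rightarrow> complex) \<Rightarrow> 'n qform \<Rightarrow> complex" where
  "simplex_integral d s h w =
     set_lebesgue_integral (Rn_measure d) (open_corner d)
       (\<lambda>t. h (s (simplex_chart d t)) * pullback_coeff d s w t)"

definition chain_integral ::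
  "nat \<Rightarrow> (complex ^ 'n::finite) chain \<Rightarrow> (complex ^ 'n \<Rightarrow> complex) \<Rightarrow> 'n qform \<Rightarrow> complex" where
  "chain_integral d \<sigma> h w =
     (\<Sum>s\<in>Poly_Mapping.keys \<sigma>. of_int (Poly_Mapping.lookup \<sigma> s) * simplex_integral d s h w)"

definition chain_support :: "nat \<Rightarrow> (complex ^ 'n::finite) chain \<Rightarrow> (complex ^ 'n) set" where
  "chain_support d \<sigma> = (\<Union>s\<in>Poly_Mapping.keys \<sigma>. s ` standard_simplex d)"

text \<open>Compact relative \<open>d\<close>-chains on \<open>X(\<complex>)\<close>, in its analytic topology, with boundary in \<open>Y(\<complex>)\<close>.\<close>

definition relative_C1_chain ::
  "nat \<Rightarrow> (complex ^ 'n::finite) set \<Rightarrow> (complex ^ 'n) set \<Rightarrow> (complex ^ 'n) chain \<Rightarrow> bool" where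
  "relative_C1_chain d X Y \<sigma> \<longleftrightarrow>
     singular_relcycle d (top_of_set X) Y \<sigma> \<and>
     (\<forall>s\<in>Poly_Mapping.keys \<sigma>. C1_singular_simplex d s)"


section \<open>Lattices, period matrices and transfinite diameters\<close>

definition rat_combinations :: "nat \<Rightarrow> (nat \<Rightarrow> real) \<Rightarrow> real set" where
  "rat_combinations m \<xi> = {\<Sum>k=1..m. of_rat (q k) * \<xi> k | q. True}"

definition int_combinations :: "nat \<Rightarrow> (nat \<Rightarrow> real) \<Rightarrow> real set" where
  "int_combinations m \<xi> = {\<Sum>k=1..m. of_int (q k) * \<xi> k | q. True}"

definition rat_polys_at :: "real \<Rightarrow> real set" where
  "rat_polys_at x = {poly (map_poly of_rat p) x | p :: rat poly. True}"

text \<open>Linear independence over \<open>\<rat>\<close> as functions on \<open>X\<close>. Finite families \<open>F\<^sub>1,\<dots>,F\<^sub>N\<close> are indexed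
  by \<open>{..<N}\<close>, as matrices are.\<close>

definition lin_indep_on ::
  "'a set \<Rightarrow> nat \<Rightarrow> (nat \<Rightarrow> 'a \<Rightarrow> complex) \<Rightarrow> bool" where
  "lin_indep_on X N F \<longleftrightarrow>
     (\<forall>c :: nat \<Rightarrow> rat. (\<forall>z\<in>X. (\<Sum>i<N. of_rat (c i) * F i z) = 0) \<longrightarrow> (\<forall>i<N. c i = 0))"

definition period_matrix ::
  "nat \<Rightarrow> (complex ^ 'n::finite) chain \<Rightarrow> 'n qform \<Rightarrow> nat \<Rightarrow> (nat \<Rightarrow> complex ^ 'n \<Rightarrow> complex) \<Rightarrow> complex Matrix.mat" where
  "period_matrix d \<sigma> w N F =
     Matrix.mat N N (\<lambda>(i, j). chain_integral d \<sigma> (\<lambda>z. F i z * F j z) w)"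

definition t_sup :: "'a set \<Rightarrow> nat \<Rightarrow> (nat \<Rightarrow> 'a \<Rightarrow> complex) \<Rightarrow> real" where
  "t_sup S N F =
     (SUP z\<in>{..<N} \<rightarrow>\<^sub>E S. cmod (Determinant.det (Matrix.mat N N (\<lambda>(i, j). F i (z j)))))"

definition GL_Q :: "nat \<Rightarrow> rat Matrix.mat set" where
  "GL_Q N = {D \<in> carrier_mat N N. invertible_mat D}"

end

(*
  Suppose that xi, hence every xi_i, is rational, and let b be a common denominator. Then the
  non-zero number det (D^l Q D^r) lies in b^(-N) Z. On the other hand, Andreief's identity
  expresses N! det Q as the integral of det (f_i(z_j))^2 over sigma^N, so that
  |det (D^l Q D^r)| <= t^2 delta V^N / N! for a constant V independent of N. Since
  (b V)^N < N! for large N, this is a contradiction once t^2 delta < 1.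
*)
theory Submission
  imports Defs
begin

text \<open>The constant \<open>V\<close> is the sum, over the simplices of the chain, of the
  absolute multiplicity times the L1 norm of the pulled-back form on the open corner. It involves
  neither the test function nor \<open>N\<close>, which is what lets the factorial win. Most of the
  analysis serves to justify this constant. The Bochner integral of a non-integrable function is 0
  by convention, so linearity and the norm estimate become usable only after integrability has been
  shown. The pullback coefficient is built from derivatives at interior points of the corner; the C1
  extension past the closed corner makes it agree there with a function continuous up to the
  boundary, hence bounded by compactness. Test functions are taken continuous on the whole affine
  space. This covers the regular functions, as they are given by polynomials.\<close>

section \<open>Andreief's identity for a bounded linear functional\<close>

text \<open>This replaces integration over the \<open>N\<close>-fold product: a bounded linear functional is applied
  successively in each of the \<open>N\<close> variables, so that no product measure is needed.\<close>

lemma iterated_functional_bound: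
  fixes L :: "('a::topological_space \<Rightarrow> complex) \<Rightarrow> complex"
    and g :: "'b \<Rightarrow> nat \<Rightarrow> 'a \<Rightarrow> complex"
  assumes fin: "finite A"
    and lin: "\<And>c h. (\<And>a. a \<in> A \<Longrightarrow> continuous_on UNIV (h a)) \<Longrightarrow>
      L (\<lambda>z. \<Sum>a\<in>A. c a * h a z) = (\<Sum>a\<in>A. c a * L (h a))"
    and bound: "\<And>h B. continuous_on UNIV h \<Longrightarrow> (\<And>z. z \<in> K \<Longrightarrow> cmod (h z) \<le> B) \<Longrightarrow> cmod (L h) \<le> V * B"
    and cont: "\<And>a j. a \<in> A \<Longrightarrow> j < N \<Longrightarrow> continuous_on UNIV (g a j)"
    and le: "\<And>z. (\<And>j. j < N \<Longrightarrow> z j \<in> K) \<Longrightarrow> cmod (\<Sum>a\<in>A. c a * (\<Prod>j<N. g a j (z j))) \<le> B"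
  shows "cmod (\<Sum>a\<in>A. c a * (\<Prod>j<N. L (g a j))) \<le> V ^ N * B"
  using cont le
proof (induction N arbitrary: c B)
  case 0
  then show ?case by simp
next
  case (Suc N)
  \<comment> \<open>The first \<open>N\<close> variables have been integrated out and the last one,
    \<open>w\<close>, is still free; applying \<open>L\<close> once more yields the sum to be
    estimated.\<close>
  define h where "h = (\<lambda>w. \<Sum>a\<in>A. (c a * (\<Prod>j<N. L (g a j))) * g a N w)"
  have h: "L h = (\<Sum>a\<in>A. (c a * (\<Prod>j<N. L (g a j))) * L (g a N))"
    unfolding h_def by (intro lin Suc.prems(1)) auto
  have "cmod (h w) \<le> V ^ N * B" if w: "w \<in> K" for w
  proof -
    \<comment> \<open>With \<open>w\<close> fixed, the factor \<open>g a N w\<close> is absorbed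
      into the coefficients, which is why the induction generalizes over \<open>c\<close>.\<close>
    have "cmod (\<Sum>a\<in>A. (c a * g a N w) * (\<Prod>j<N. L (g a j))) \<le> V ^ N * B"
    proof (rule Suc.IH)
      fix z assume z: "\<And>j. j < N \<Longrightarrow> z j \<in> K"
      have "cmod (\<Sum>a\<in>A. c a * (\<Prod>j<Suc N. g a j ((z(N := w)) j))) \<le> B"
        by (rule Suc.prems(2)) (use z w less_Suc_eq in auto)
      then show "cmod (\<Sum>a\<in>A. c a * g a N w * (\<Prod>j<N. g a j (z j))) \<le> B"
        by (simp add: mult_ac)
    qed (use Suc.prems(1) in auto)
    then show ?thesis by (simp add: h_def mult_ac)
  qed
  moreover have "continuous_on UNIV h"
    unfolding h_def by (intro continuous_intros Suc.prems(1)) auto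
  ultimately have "cmod (L h) \<le> V * (V ^ N * B)" by (intro bound)
  then show ?case by (simp add: h mult_ac)
qed

text \<open>The square of the determinant is a double sum over permutations \<open>p\<close>,
  \<open>q\<close>. After \<open>L\<close> is applied in each variable, the inner sum over
  \<open>q\<close> is the determinant of the Gram matrix with rows permuted by \<open>p\<close>. Its
  sign cancels the sign of \<open>p\<close>, leaving \<open>fact N\<close> equal terms. The index
  type in \<open>lin\<close> is fixed to pairs of maps because an assumption cannot be polymorphic,
  and these pairs are the \<open>(p, q)\<close>.\<close>

lemma det_bilinear_functional_bound:
  fixes L :: "('a::topological_space \<Rightarrow> complex) \<Rightarrow> complex" and F :: "nat \<Rightarrow> 'a \<Rightarrow> complex"
  assumes lin: "\<And>A :: ((nat \<Rightarrow> nat) \<times> (nat \<Rightarrow> nat)) set. \<And>c h. finite A \<Longrightarrow> (\<And>a. a \<in> A \<Longrightarrow> continuous_on UNIV (h a)) \<Longrightarrow>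
      L (\<lambda>z. \<Sum>a\<in>A. c a * h a z) = (\<Sum>a\<in>A. c a * L (h a))"
    and bound: "\<And>h B. continuous_on UNIV h \<Longrightarrow> (\<And>z. z \<in> K \<Longrightarrow> cmod (h z) \<le> B) \<Longrightarrow> cmod (L h) \<le> V * B"
    and cont: "\<And>i. i < N \<Longrightarrow> continuous_on UNIV (F i)"
    and le: "\<And>z. (\<And>j. j < N \<Longrightarrow> z j \<in> K) \<Longrightarrow> cmod (Determinant.det (Matrix.mat N N (\<lambda>(i, j). F i (z j)))) \<le> t"
  shows "fact N * cmod (Determinant.det (Matrix.mat N N (\<lambda>(i, j). L (\<lambda>z. F i z * F j z)))) \<le> V ^ N * t\<^sup>2"
proof -
  define P where "P = {p. p permutes {0..<N}}"
  define s :: "(nat \<Rightarrow> nat) \<Rightarrow> complex" where "s = (\<lambda>p. signof p)"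
  define Q where "Q = Matrix.mat N N (\<lambda>(i, j). L (\<lambda>z. F i z * F j z))"
  have fin: "finite P" unfolding P_def by (simp add: finite_permutations)
  have pl: "p j < N" if "p \<in> P" "j < N" for p j
    using that permutes_in_image[of p "{0..<N}" j] by (auto simp: P_def)
  \<comment> \<open>The expansion runs over columns, so that each variable \<open>z j\<close> occurs
    in exactly one factor.\<close>
  have detF: "Determinant.det (Matrix.mat N N (\<lambda>(i, j). F i (z j))) = (\<Sum>p\<in>P. s p * (\<Prod>j<N. F (p j) (z j)))" for z
    by (subst det_col[of _ N]) (auto simp: P_def[symmetric] s_def pl intro!: sum.cong prod.cong)
  have "cmod (\<Sum>a\<in>P \<times> P. (s (fst a) * s (snd a)) * (\<Prod>j<N. L (\<lambda>z. F (fst a j) z * F (snd a j) z)))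
      \<le> V ^ N * t\<^sup>2"
  proof (rule iterated_functional_bound[where K = K and c = "\<lambda>a. s (fst a) * s (snd a)"
        and g = "\<lambda>a j z. F (fst a j) z * F (snd a j) z"])
    fix z assume z: "\<And>j. j < N \<Longrightarrow> z j \<in> K"
    have "(\<Sum>a\<in>P \<times> P. s (fst a) * s (snd a) * (\<Prod>j<N. F (fst a j) (z j) * F (snd a j) (z j)))
       = (Determinant.det (Matrix.mat N N (\<lambda>(i, j). F i (z j))))\<^sup>2"
      unfolding detF by (simp add: power2_eq_square sum_product sum.cartesian_product prod.distrib mult_ac split_def)
    then show "cmod (\<Sum>a\<in>P \<times> P. s (fst a) * s (snd a) * (\<Prod>j<N. F (fst a j) (z j) * F (snd a j) (z j))) \<le> t\<^sup>2"
      using le[OF z] by (simp add: norm_power power_mono)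
  qed (use fin pl in \<open>auto intro!: lin bound continuous_intros cont\<close>)
  moreover have "(\<Sum>a\<in>P \<times> P. (s (fst a) * s (snd a)) * (\<Prod>j<N. L (\<lambda>z. F (fst a j) z * F (snd a j) z)))
      = fact N * Determinant.det Q"
  proof -
    have "(\<Sum>a\<in>P \<times> P. (s (fst a) * s (snd a)) * (\<Prod>j<N. L (\<lambda>z. F (fst a j) z * F (snd a j) z)))
       = (\<Sum>p\<in>P. s p * (\<Sum>q\<in>P. s q * (\<Prod>j<N. L (\<lambda>z. F (p j) z * F (q j) z))))"
      by (simp add: sum_distrib_left sum.cartesian_product split_def mult_ac)
    also have "\<dots> = (\<Sum>p\<in>P. s p * (s p * Determinant.det Q))"
    proof (rule sum.cong[OF refl], goal_cases)
      case (1 p)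
      have "(\<Sum>q\<in>P. s q * (\<Prod>j<N. L (\<lambda>z. F (p j) z * F (q j) z)))
          = Determinant.det (Matrix.mat N N (\<lambda>(i, j). Q $$ (p i, j)))"
        by (subst det_def'[of _ N])
           (auto simp: P_def[symmetric] s_def Q_def pl 1 lessThan_atLeast0 intro!: sum.cong prod.cong)
      also have "\<dots> = s p * Determinant.det Q"
        unfolding s_def by (rule det_permute_rows) (use 1 in \<open>auto simp: Q_def P_def\<close>)
      finally show ?case by simp
    qed
    also have "\<dots> = (\<Sum>p\<in>P. Determinant.det Q)"
      by (intro sum.cong refl) (simp add: s_def sign_def)
    also have "\<dots> = fact N * Determinant.det Q"
      by (simp add: P_def card_permutations[OF refl])
    finally show ?thesis .
  qed
  ultimately show ?thesis by (simp add: Q_def norm_mult)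
qed

section \<open>Factorial growth and common denominators\<close>

lemma power_eventually_less_fact:
  fixes x :: real
  shows "\<forall>\<^sub>F n in sequentially. x ^ n < fact n"
proof -
  have "(\<lambda>n. x ^ n / fact n) \<longlonglongrightarrow> 0"
    using summable_LIMSEQ_zero[OF summable_exp[of x]] by (simp add: field_simps)
  then have "\<forall>\<^sub>F n in sequentially. x ^ n / fact n < 1"
    by (rule order_tendstoD) simp
  then show ?thesis by (simp add: divide_less_eq)
qed

lemma rat_polys_at_Rats: "\<xi> \<in> \<rat> \<Longrightarrow> y \<in> rat_polys_at \<xi> \<Longrightarrow> y \<in> \<rat>"
  by (auto simp: rat_polys_at_def poly_altdef coeff_map_poly intro!: Rats_sum Rats_mult Rats_power)

lemma Rats_common_denominator:
  fixes x :: "'a \<Rightarrow> real"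
  assumes "finite I" and "\<And>i. i \<in> I \<Longrightarrow> x i \<in> \<rat>"
  obtains b :: nat where "b > 0" and "\<And>i. i \<in> I \<Longrightarrow> of_nat b * x i \<in> \<int>"
proof -
  have "\<exists>b::nat. b > 0 \<and> (\<forall>i\<in>I. of_nat b * x i \<in> \<int>)"
    using assms
  proof (induction I)
    case (insert i I)
    then obtain b :: nat where b: "b > 0" "\<forall>i\<in>I. of_nat b * x i \<in> \<int>" by auto
    obtain p q :: int where q: "q > 0" and x: "x i = of_int p / of_int q"
      using insert.prems[of i] by (auto elim: Rats_cases')
    have "of_nat (b * nat q) * x j \<in> \<int>" if "j \<in> insert i I" for j
    proof (cases "j = i")
      case True
      have "of_nat (b * nat q) * x j = of_int (int b * p)" using q by (simp add: True x)
      then show ?thesis by (metis Ints_of_int)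
    next
      case False
      then have "of_nat (b * nat q) * x j = of_nat (nat q) * (of_nat b * x j)" "of_nat b * x j \<in> \<int>" using that b by auto
      then show ?thesis by (metis Ints_mult Ints_of_nat)
    qed
    then show ?case using b q by (intro exI[of _ "b * nat q"]) auto
  qed (auto intro: exI[of _ 1])
  then show ?thesis using that by auto
qed

lemma int_combinations_mult_Ints:
  assumes "\<And>i. i \<in> {1..m} \<Longrightarrow> of_nat b * x i \<in> \<int>" and "y \<in> int_combinations m x"
  shows "of_nat b * y \<in> \<int>"
proof -
  obtain q :: "nat \<Rightarrow> int" where y: "y = (\<Sum>k=1..m. of_int (q k) * x k)"
    using assms(2) by (auto simp: int_combinations_def)
  have "of_nat b * y = (\<Sum>k=1..m. of_int (q k) * (of_nat b * x k))"
    unfolding y sum_distrib_left by (intro sum.cong) auto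
  also have "\<dots> \<in> \<int>" by (intro Ints_sum Ints_mult Ints_of_int assms(1))
  finally show ?thesis .
qed

text \<open>Scaling by \<open>b\<close> gives an integer matrix, and scaling each of the
  \<open>N\<close> rows multiplies the determinant by \<open>b ^ N\<close>. A non-zero integer has
  absolute value at least 1.\<close>

lemma cmod_det_ge_of_bounded_denominator:
  fixes A :: "complex Matrix.mat"
  assumes A: "A \<in> carrier_mat N N"
    and Ints: "\<And>i j. i < N \<Longrightarrow> j < N \<Longrightarrow> of_nat b * A $$ (i, j) \<in> \<int>"
    and nz: "Determinant.det A \<noteq> 0"
    and b: "b > 0"
  shows "1 \<le> of_nat b ^ N * cmod (Determinant.det A)"
proof -
  have "\<forall>i j. \<exists>k. i < N \<longrightarrow> j < N \<longrightarrow> of_nat b * A $$ (i, j) = of_int k"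
    using Ints by (meson Ints_cases)
  then obtain k where k: "\<And>i j. i < N \<Longrightarrow> j < N \<Longrightarrow> of_nat b * A $$ (i, j) = of_int (k i j)"
    by metis
  have "of_nat b \<cdot>\<^sub>m A = map_mat of_int (Matrix.mat N N (\<lambda>(i, j). k i j))"
    by (rule eq_matI) (use A k in auto)
  then have "of_nat b ^ N * Determinant.det A = of_int (Determinant.det (Matrix.mat N N (\<lambda>(i, j). k i j)))"
    by (metis A carrier_matD(2) det_smult of_int_hom.hom_det)
  moreover have "of_nat b ^ N * Determinant.det A \<noteq> 0" using nz b by simp
  ultimately obtain l :: int where l: "of_nat b ^ N * Determinant.det A = of_int l" "l \<noteq> 0" by auto
  have "1 \<le> cmod (of_int l)" using l(2) by simp
  also have "\<dots> = of_nat b ^ N * cmod (Determinant.det A)" by (simp add: l(1)[symmetric] norm_mult norm_power)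
  finally show ?thesis .
qed

lemma invertible_mat_det_nonzero:
  fixes D :: "'a::field Matrix.mat"
  assumes "D \<in> carrier_mat N N" "invertible_mat D"
  shows "Determinant.det D \<noteq> 0"
proof -
  obtain B where B: "D * B = 1\<^sub>m N" "B * D = 1\<^sub>m (dim_row B)"
    using assms by (auto simp: invertible_mat_def inverts_mat_def)
  have "B \<in> carrier_mat N N"
    using B assms(1) by (metis carrier_matD(2) carrier_matI index_mult_mat(2,3) index_one_mat(2,3))
  then have "Determinant.det D * Determinant.det B = 1"
    using assms(1) B(1) by (metis det_mult det_one)
  then show ?thesis by auto
qed

section \<open>Compactness and integrability on the corner\<close>

text \<open>The corner, transported from extensional functions to functions on \<open>nat\<close> that vanish outside
  \<open>{..<d}\<close>. There the product topology is an instance of the topological type classes, so that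
  continuity on sets and Borel measurability are available.\<close>

definition real_corner :: "nat \<Rightarrow> (nat \<Rightarrow> real) set" where
  "real_corner d = {x. (\<forall>i<d. 0 \<le> x i) \<and> (\<forall>i\<ge>d. x i = 0) \<and> (\<Sum>i<d. x i) \<le> 1}"

text \<open>Closed and bounded would not suffice in an infinite product. The corner is instead a
  closed subset of the cube of all sequences in [0,1], which is compact by Tychonoff's
  theorem.\<close>

lemma compact_real_corner: "compact (real_corner d)"
proof -
  have "compactin (product_topology (\<lambda>i::nat. euclidean) UNIV) (PiE UNIV (\<lambda>_. {0..1::real}))"
    by (simp add: compactin_PiE)
  then have "compact (PiE UNIV (\<lambda>_::nat. {0..1::real}))"
    by (simp add: euclidean_product_topology)
  moreover have "closed (real_corner d)"
  proof -
    have eq: "real_corner d = (\<Inter>i\<in>{..<d}. {x. 0 \<le> x i}) \<inter> (\<Inter>i\<in>{d..}. {x. x i = 0}) \<inter> {x. (\<Sum>i<d. x i) \<le> 1}"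
      by (auto simp: real_corner_def)
    show ?thesis unfolding eq
      by (intro closed_Int closed_INT ballI closed_Collect_le closed_Collect_eq continuous_intros)
        (auto intro!: continuous_intros)
  qed
  moreover have "real_corner d \<subseteq> PiE UNIV (\<lambda>_::nat. {0..1::real})"
  proof
    fix x assume x: "x \<in> real_corner d"
    have "x i \<in> {0..1}" for i
    proof (cases "i < d")
      case True
      then have "x i \<le> (\<Sum>i<d. x i)" using x by (intro member_le_sum) (auto simp: real_corner_def)
      with x True show ?thesis by (auto simp: real_corner_def)
    qed (use x in \<open>auto simp: real_corner_def\<close>)
    then show "x \<in> PiE UNIV (\<lambda>_::nat. {0..1::real})" by auto
  qed
  ultimately show ?thesis by (metis compact_Int_closed inf.absorb2)
qed

lemma restrict_real_corner: "x \<in> real_corner d \<Longrightarrow> restrict x {..<d} \<in> closed_corner d"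
  by (auto simp: real_corner_def closed_corner_def)

lemma open_corner_subset_closed_corner: "open_corner d \<subseteq> closed_corner d"
  by (auto simp: open_corner_def closed_corner_def less_imp_le)

lemma closed_corner_zero_extension:
  assumes "t \<in> closed_corner d"
  shows "(\<lambda>i. if i < d then t i else 0) \<in> real_corner d"
    and "restrict (\<lambda>i. if i < d then t i else 0) {..<d} = t"
proof -
  show "(\<lambda>i. if i < d then t i else 0) \<in> real_corner d"
    using assms by (auto simp: closed_corner_def real_corner_def)
  show "restrict (\<lambda>i. if i < d then t i else 0) {..<d} = t"
    using assms by (auto simp: closed_corner_def extensional_def fun_eq_iff)
qed

text \<open>Composition with this map turns the continuity of the partial derivatives on the
  neighbourhood \<open>U\<close> into ordinary continuity on \<open>real_corner d\<close>.\<close>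

lemma continuous_map_restrict_real_corner:
  assumes "closed_corner d \<subseteq> U"
  shows "continuous_map (top_of_set (real_corner d)) (subtopology (Rn_top d) U) (\<lambda>x. restrict x {..<d})"
  unfolding continuous_map_in_subtopology
proof
  show "continuous_map (top_of_set (real_corner d)) (Rn_top d) (\<lambda>x. restrict x {..<d})"
    unfolding continuous_map_componentwise
    by (auto intro!: continuous_on_subset[OF continuous_on_product_coordinates])
  show "(\<lambda>x. restrict x {..<d}) \<in> topspace (top_of_set (real_corner d)) \<rightarrow> U"
    using restrict_real_corner assms by (auto simp: Pi_iff)
qed

lemma sets_open_corner: "open_corner d \<in> sets (Rn_measure d)"
proof -
  have "open_corner d = {t \<in> space (Rn_measure d). (\<forall>i\<in>{..<d}. 0 < t i) \<and> (\<Sum>i<d. t i) < 1}"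
    by (auto simp: open_corner_def space_PiM PiE_def)
  also have "\<dots> \<in> sets (Rn_measure d)" by measurable
  finally show ?thesis .
qed

lemma emeasure_open_corner_finite: "emeasure (Rn_measure d) (open_corner d) < \<infinity>"
proof -
  interpret product_sigma_finite "\<lambda>_::nat. lborel :: real measure" by standard
  have "open_corner d \<subseteq> PiE {..<d} (\<lambda>_. {0..1})"
  proof
    fix t assume t: "t \<in> open_corner d"
    have "t i \<le> (\<Sum>i<d. t i)" if "i < d" for i
      using t that by (intro member_le_sum) (auto simp: open_corner_def less_imp_le)
    then have "t i \<le> 1" if "i < d" for i
      using t that by (force simp: open_corner_def)
    with t show "t \<in> PiE {..<d} (\<lambda>_. {0..1})"
      by (auto simp: open_corner_def PiE_iff less_imp_le)
  qed
  then have "emeasure (Rn_measure d) (open_corner d) \<le> emeasure (Rn_measure d) (PiE {..<d} (\<lambda>_. {0..1}))"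
    by (intro emeasure_mono sets_PiM_I_finite) auto
  also have "\<dots> = 1" by (subst emeasure_PiM) auto
  finally show ?thesis using le_less_trans by fastforce
qed

text \<open>Continuity is required up to the boundary: compactness of the closed corner then bounds
  \<open>q\<close>, and the open corner has finite measure. Measurability is obtained by factoring
  \<open>q\<close> through the zero extension \<open>e\<close>.\<close>

lemma set_integrable_open_corner:
  fixes q :: "(nat \<Rightarrow> real) \<Rightarrow> complex"
  assumes q: "continuous_on (real_corner d) (\<lambda>x. q (restrict x {..<d}))"
  shows "set_integrable (Rn_measure d) (open_corner d) q"
proof -
  define e where "e = (\<lambda>t i. if i < d then t i else (0::real))"
  define q' where "q' = (\<lambda>x. indicator (real_corner d) x *\<^sub>R q (restrict x {..<d}))"
  have "e \<in> measurable (Rn_measure d) (Pi\<^sub>M UNIV (\<lambda>_. borel))"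
  proof (rule measurable_PiM_single')
    fix i show "(\<lambda>t. e t i) \<in> borel_measurable (Rn_measure d)"
      by (cases "i < d") (auto simp: e_def)
  qed (auto simp: space_PiM)
  \<comment> \<open>For countably many factors the product sigma-algebra is the Borel sigma-algebra
    of the product topology.\<close>
  then have e: "e \<in> measurable (Rn_measure d) borel"
    by (simp add: sets_PiM_equal_borel cong: measurable_cong_sets)
  have "q' \<in> borel_measurable borel"
    unfolding q'_def
    by (intro borel_measurable_continuous_on_indicator q borel_closed compact_imp_closed compact_real_corner)
  then have meas: "(\<lambda>t. q' (e t)) \<in> borel_measurable (Rn_measure d)"
    using e by simp
  have "compact ((\<lambda>x. q (restrict x {..<d})) ` real_corner d)"
    by (intro compact_continuous_image q compact_real_corner)
  then obtain B where B: "\<And>x. x \<in> real_corner d \<Longrightarrow> norm (q (restrict x {..<d})) \<le> B"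
    by (meson bounded_iff compact_imp_bounded image_eqI)
  have q': "q' (e t) = q t" and e_in: "norm (q t) \<le> B" if "t \<in> open_corner d" for t
  proof -
    have "t \<in> closed_corner d" using that open_corner_subset_closed_corner by blast
    then have "e t \<in> real_corner d" "restrict (e t) {..<d} = t"
      unfolding e_def by (auto intro: closed_corner_zero_extension)
    then show "q' (e t) = q t" "norm (q t) \<le> B" using B[of "e t"] by (simp_all add: q'_def)
  qed
  have "integrable (Rn_measure d) (\<lambda>t. indicator (open_corner d) t *\<^sub>R q' (e t))"
    by (rule integrableI_bounded_set_indicator[OF sets_open_corner meas emeasure_open_corner_finite])
       (use q' e_in in auto)
  then show ?thesis unfolding set_integrable_def
    by (rule Bochner_Integration.integrable_cong[THEN iffD1, rotated -1]) (auto simp: q' indicator_def)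
qed

section \<open>Simplices and forms in the chart\<close>

lemma simplex_chart_standard_simplex:
  assumes "t \<in> closed_corner d"
  shows "simplex_chart d t \<in> standard_simplex d"
proof -
  have t: "\<And>i. i < d \<Longrightarrow> 0 \<le> t i" "(\<Sum>i<d. t i) \<le> 1" using assms by (auto simp: closed_corner_def)
  have "t i \<le> (\<Sum>i<d. t i)" if "i < d" for i
    using t(1) that by (intro member_le_sum) auto
  then have le: "t i \<le> 1" if "i < d" for i using t that by fastforce
  \<comment> \<open>Split off barycentric coordinate 0; the others add up to exactly what it
    subtracts from 1.\<close>
  have "(\<Sum>i\<le>d. simplex_chart d t i) = 1"
    unfolding atMost_Suc_eq_insert_0 lessThan_Suc_atMost[symmetric] sum.lessThan_Suc_shift
    by (simp add: simplex_chart_def)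
  moreover have "0 \<le> (\<Sum>i<d. t i)" using t(1) by (intro sum_nonneg) auto
  ultimately show ?thesis
    using t le by (auto simp: standard_simplex_def simplex_chart_def split: nat.split)
qed

lemma continuous_on_simplex_in_chart:
  assumes "singular_simplex d (top_of_set X) s"
  shows "continuous_on (real_corner d) (\<lambda>x. s (simplex_chart d (restrict x {..<d})))"
proof (rule continuous_on_compose2[where f = "\<lambda>x. simplex_chart d (restrict x {..<d})"])
  show "continuous_on (standard_simplex d) s"
    using assms by (simp add: singular_simplex_def continuous_map_in_subtopology euclidean_product_topology)
  show "continuous_on (real_corner d) (\<lambda>x. simplex_chart d (restrict x {..<d}))"
  proof (rule continuous_on_coordinatewise_then_product)
    fix i show "continuous_on (real_corner d) (\<lambda>x. simplex_chart d (restrict x {..<d}) i)"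
    proof (cases i)
      case (Suc j)
      then show ?thesis
        by (cases "j < d") (auto simp: simplex_chart_def intro: continuous_on_subset[OF continuous_on_product_coordinates])
    qed (auto simp: simplex_chart_def intro!: continuous_intros continuous_on_subset[OF continuous_on_product_coordinates])
  qed
qed (use simplex_chart_standard_simplex restrict_real_corner in blast)

lemma continuous_on_regfun [continuous_intros]:
  assumes "continuous_on A h"
  shows "continuous_on A (\<lambda>x. regfun g (h x))"
  unfolding regfun_def qeval_def by (intro continuous_intros assms)

lemma continuous_on_poly_in: "continuous_on A (poly_in f P)"
  unfolding poly_in_def qeval_def by (intro continuous_intros)

lemma continuous_on_det [continuous_intros]:
  fixes h :: "nat \<Rightarrow> nat \<Rightarrow> 'a::topological_space \<Rightarrow> complex"
  assumes "\<And>i j. i < n \<Longrightarrow> j < n \<Longrightarrow> continuous_on A (h i j)"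
  shows "continuous_on A (\<lambda>x. Determinant.det (Matrix.mat n n (\<lambda>(i, j). h i j x)))"
proof -
  have eq: "Determinant.det (Matrix.mat n n (\<lambda>(i, j). h i j x))
     = (\<Sum>p | p permutes {0..<n}. signof p * (\<Prod>i=0..<n. h i (p i) x))" for x
    by (subst det_def'[of _ n]) (auto intro!: sum.cong prod.cong)
  show ?thesis unfolding eq
    by (intro continuous_intros assms) (auto simp: permutes_in_image dest: permutes_in_image)
qed

text \<open>Near an interior point each coordinate line stays in the corner, so in a partial
  derivative the simplex may be replaced by its C1 extension.\<close>

lemma eventually_fun_upd_open_corner:
  assumes t: "t \<in> open_corner d" and b: "b < d"
  shows "\<forall>\<^sub>F x in nhds (t b). t(b := x) \<in> open_corner d"
proof -
  define S where "S = (\<Sum>i\<in>{..<d} - {b}. t i)"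
  have sum: "(\<Sum>i<d. (t(b := x)) i) = x + S" for x
    using b by (subst sum.remove[of _ b]) (auto simp: S_def)
  from sum[of "t b"] t have "t b + S < 1" by (simp add: open_corner_def)
  moreover have "0 < t b" using t b by (simp add: open_corner_def)
  ultimately have "\<forall>\<^sub>F x in nhds (t b). x \<in> {0<..<1 - S}"
    by (intro eventually_nhds_in_open) auto
  then show ?thesis
  proof eventually_elim
    case (elim x)
    with sum[of x] t b show ?case by (auto simp: open_corner_def extensional_def)
  qed
qed

text \<open>The derivatives of the simplex are controlled only at interior points, whereas
  \<open>g'\<close> is continuous on a neighbourhood of the closed corner. Substituting
  \<open>g'\<close> for them gives \<open>c\<close>.\<close>

lemma pullback_coeff_continuous_extension:
  fixes s :: "(nat \<Rightarrow> real) \<Rightarrow> complex ^ 'n::finite"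
  assumes s: "singular_simplex d (top_of_set X) s" and C1: "C1_singular_simplex d s"
  obtains c where "continuous_on (real_corner d) (\<lambda>x. c (restrict x {..<d}))"
    and "\<And>t. t \<in> open_corner d \<Longrightarrow> pullback_coeff d s w t = c t"
proof -
  obtain U g g' where U: "openin (Rn_top d) U" "closed_corner d \<subseteq> U"
    and g: "\<And>t. t \<in> closed_corner d \<Longrightarrow> g t = s (simplex_chart d t)"
    and g': "\<And>j t. j < d \<Longrightarrow> t \<in> U \<Longrightarrow> ((\<lambda>x. g (t(j := x))) has_vector_derivative g' j t) (at (t j))"
    and cont: "\<And>j. j < d \<Longrightarrow> continuous_map (subtopology (Rn_top d) U) (euclidean :: (complex ^ 'n) topology) (g' j)"
    using C1 unfolding C1_singular_simplex_def by blast
  define c where "c = (\<lambda>t. \<Sum>J | length J = d. regfun (w J) (s (simplex_chart d t)) *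
        Determinant.det (Matrix.mat d d (\<lambda>(a, b). vec_nth (g' b t) (J ! a))))"
  have "continuous_on (real_corner d) (\<lambda>x. g' j (restrict x {..<d}))" if "j < d" for j
    using continuous_map_compose[OF continuous_map_restrict_real_corner[OF U(2)] cont[OF that]]
    by (simp add: o_def)
  then have "continuous_on (real_corner d) (\<lambda>x. c (restrict x {..<d}))"
    unfolding c_def by (intro continuous_intros continuous_on_simplex_in_chart[OF s])
  moreover have "pullback_coeff d s w t = c t" if t: "t \<in> open_corner d" for t
  proof -
    have "vector_derivative (\<lambda>x. vec_nth (s (simplex_chart d (t(b := x)))) k) (at (t b)) = vec_nth (g' b t) k"
      if b: "b < d" for b k
    proof (rule vector_derivative_at)
      have "((\<lambda>x. vec_nth (g (t(b := x))) k) has_vector_derivative vec_nth (g' b t) k) (at (t b))"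
        using t U(2) open_corner_subset_closed_corner b
        by (intro bounded_linear.has_vector_derivative[OF bounded_linear_vec_nth] g') auto
      moreover have "\<forall>\<^sub>F x in nhds (t b). vec_nth (g (t(b := x))) k = vec_nth (s (simplex_chart d (t(b := x)))) k"
        using eventually_fun_upd_open_corner[OF t b]
        by eventually_elim (use g subsetD[OF open_corner_subset_closed_corner] in metis)
      ultimately show "((\<lambda>x. vec_nth (s (simplex_chart d (t(b := x)))) k) has_vector_derivative vec_nth (g' b t) k) (at (t b))"
        \<comment> \<open>The congruence rule also needs agreement at the point itself, which
          follows from agreement near it.\<close>
        by (subst (asm) has_vector_derivative_cong_ev) (auto dest: eventually_nhds_x_imp_x)
    qed
    then show ?thesis unfolding pullback_coeff_def c_def
      by (intro sum.cong refl arg_cong2[where f = "(*)"] arg_cong[where f = Determinant.det] cong_mat) auto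
  qed
  ultimately show ?thesis using that by blast
qed

section \<open>Suprema over the support of the chain\<close>

lemma bounded_continuous_image_chain_support:
  fixes h :: "complex ^ 'n::finite \<Rightarrow> complex"
  assumes \<sigma>: "singular_chain d (top_of_set X) \<sigma>" and h: "continuous_on UNIV h"
  obtains C where "\<And>z. z \<in> chain_support d \<sigma> \<Longrightarrow> cmod (h z) \<le> C"
proof -
  have "compact (s ` standard_simplex d)" if s: "s \<in> Poly_Mapping.keys \<sigma>" for s
  proof (rule compact_continuous_image)
    have "singular_simplex d (top_of_set X) s" using \<sigma> s by (auto simp: singular_chain_def)
    then show "continuous_on (standard_simplex d) s"
      by (simp add: singular_simplex_def continuous_map_in_subtopology euclidean_product_topology)
    show "compact (standard_simplex d)"
      using compactin_standard_simplex[of d] by (simp add: euclidean_product_topology)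
  qed
  then have "compact (chain_support d \<sigma>)" unfolding chain_support_def by (intro compact_UN) auto
  then have "compact (h ` chain_support d \<sigma>)" by (rule compact_continuous_image[rotated]) (use h continuous_on_subset in blast)
  then show ?thesis using that by (meson bounded_iff compact_imp_bounded image_eqI)
qed

text \<open>A real \<open>SUP\<close> dominates its members only if they are bounded above. The
  Leibniz expansion supplies a bound from bounds on the individual functions.\<close>

lemma t_sup_upper:
  fixes F :: "nat \<Rightarrow> 'a \<Rightarrow> complex"
  assumes bounded: "\<And>i. i < N \<Longrightarrow> \<exists>C. \<forall>z\<in>S. cmod (F i z) \<le> C"
    and z: "\<And>j. j < N \<Longrightarrow> z j \<in> S"
  shows "cmod (Determinant.det (Matrix.mat N N (\<lambda>(i, j). F i (z j)))) \<le> t_sup S N F"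
proof -
  obtain C where C: "\<And>i z. i < N \<Longrightarrow> z \<in> S \<Longrightarrow> cmod (F i z) \<le> C i" using bounded by metis
  have "cmod (Determinant.det (Matrix.mat N N (\<lambda>(i, j). F i (y j)))) \<le> (\<Sum>p | p permutes {0..<N}. \<Prod>i=0..<N. C i)"
    if y: "y \<in> {..<N} \<rightarrow>\<^sub>E S" for y
  proof -
    have "Determinant.det (Matrix.mat N N (\<lambda>(i, j). F i (y j)))
       = (\<Sum>p | p permutes {0..<N}. signof p * (\<Prod>i=0..<N. Matrix.mat N N (\<lambda>(i, j). F i (y j)) $$ (i, p i)))"
      by (rule det_def') auto
    also have "cmod \<dots> \<le> (\<Sum>p | p permutes {0..<N}. \<Prod>i=0..<N. C i)"
    proof (rule order.trans[OF norm_sum], rule sum_mono)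
      fix p assume "p \<in> {p. p permutes {0..<N}}"
      then have p: "p i < N" if "i < N" for i using that permutes_in_image[of p "{0..<N}" i] by auto
      have "cmod (\<Prod>i=0..<N. Matrix.mat N N (\<lambda>(i, j). F i (y j)) $$ (i, p i)) \<le> (\<Prod>i=0..<N. C i)"
        unfolding prod_norm[symmetric] using y p by (intro prod_mono) (auto intro!: C)
      then show "cmod (signof p * (\<Prod>i=0..<N. Matrix.mat N N (\<lambda>(i, j). F i (y j)) $$ (i, p i))) \<le> (\<Prod>i=0..<N. C i)"
        by (simp add: norm_mult sign_def)
    qed
    finally show ?thesis .
  qed
  then have bdd: "bdd_above ((\<lambda>z. cmod (Determinant.det (Matrix.mat N N (\<lambda>(i, j). F i (z j))))) ` ({..<N} \<rightarrow>\<^sub>E S))"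
    by (intro bdd_aboveI2)
  \<comment> \<open>\<open>t_sup\<close> ranges over extensional tuples only; the matrix sees just
    the indices below \<open>N\<close>, so restricting \<open>z\<close> changes nothing.\<close>
  have "Matrix.mat N N (\<lambda>(i, j). F i (z j)) = Matrix.mat N N (\<lambda>(i, j). F i (restrict z {..<N} j))"
    by (rule cong_mat) auto
  moreover have "restrict z {..<N} \<in> {..<N} \<rightarrow>\<^sub>E S" using z by (simp add: PiE_iff)
  ultimately show ?thesis unfolding t_sup_def
    by (intro cSUP_upper2[OF bdd, of "restrict z {..<N}"]) simp_all
qed

section \<open>Linearity and boundedness of integration over the chain\<close>

lemma set_integrable_mult_pullback_coeff:
  fixes s :: "(nat \<Rightarrow> real) \<Rightarrow> complex ^ 'n::finite"
  assumes s: "singular_simplex d (top_of_set X) s" and C1: "C1_singular_simplex d s"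
    and h: "continuous_on UNIV h"
  shows "set_integrable (Rn_measure d) (open_corner d)
    (\<lambda>t. h (s (simplex_chart d t)) * pullback_coeff d s w t)"
proof -
  obtain c where c: "continuous_on (real_corner d) (\<lambda>x. c (restrict x {..<d}))"
    and eq: "\<And>t. t \<in> open_corner d \<Longrightarrow> pullback_coeff d s w t = c t"
    using pullback_coeff_continuous_extension[OF s C1] by metis
  have "set_integrable (Rn_measure d) (open_corner d) (\<lambda>t. h (s (simplex_chart d t)) * c t)"
    by (intro set_integrable_open_corner continuous_intros c
        continuous_on_compose2[OF h continuous_on_simplex_in_chart[OF s]]) auto
  then show ?thesis
    by (subst set_integrable_cong) (auto simp: eq)
qed

lemma simplex_integral_sum:
  fixes s :: "(nat \<Rightarrow> real) \<Rightarrow> complex ^ 'n::finite"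
  assumes s: "singular_simplex d (top_of_set X) s" and C1: "C1_singular_simplex d s"
    and h: "\<And>a. a \<in> A \<Longrightarrow> continuous_on UNIV (h a)"
  shows "simplex_integral d s (\<lambda>z. \<Sum>a\<in>A. c a * h a z) w = (\<Sum>a\<in>A. c a * simplex_integral d s (h a) w)"
proof -
  have "(\<Sum>a\<in>A. c a * simplex_integral d s (h a) w)
     = (\<Sum>a\<in>A. integral\<^sup>L (Rn_measure d) (\<lambda>t. indicator (open_corner d) t *\<^sub>R
           (c a * (h a (s (simplex_chart d t)) * pullback_coeff d s w t))))"
    unfolding simplex_integral_def set_lebesgue_integral_def
    by (intro sum.cong refl) (simp flip: integral_mult_right_zero)
  also have "\<dots> = integral\<^sup>L (Rn_measure d) (\<lambda>t. \<Sum>a\<in>A. indicator (open_corner d) t *\<^sub>R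
           (c a * (h a (s (simplex_chart d t)) * pullback_coeff d s w t)))"
  proof (rule Bochner_Integration.integral_sum[symmetric])
    fix a assume "a \<in> A"
    from set_integrable_mult_right[OF set_integrable_mult_pullback_coeff[OF s C1 h[OF this], of w], of "c a"]
    show "integrable (Rn_measure d) (\<lambda>t. indicator (open_corner d) t *\<^sub>R
           (c a * (h a (s (simplex_chart d t)) * pullback_coeff d s w t)))"
      by (simp add: set_integrable_def)
  qed
  finally show ?thesis
    by (simp add: simplex_integral_def set_lebesgue_integral_def sum_distrib_right scaleR_sum_right mult.assoc)
qed

lemma simplex_integral_bound:
  fixes s :: "(nat \<Rightarrow> real) \<Rightarrow> complex ^ 'n::finite"
  assumes s: "singular_simplex d (top_of_set X) s" and C1: "C1_singular_simplex d s"
    and h: "continuous_on UNIV h"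
    and B: "\<And>z. z \<in> s ` standard_simplex d \<Longrightarrow> cmod (h z) \<le> B"
  shows "cmod (simplex_integral d s h w) \<le>
    set_lebesgue_integral (Rn_measure d) (open_corner d) (\<lambda>t. cmod (pullback_coeff d s w t)) * B"
proof -
  have int: "set_integrable (Rn_measure d) (open_corner d) (pullback_coeff d s w)"
    \<comment> \<open>The constant function 1 as \<open>h\<close> gives integrability of the
      coefficient alone.\<close>
    using set_integrable_mult_pullback_coeff[OF s C1 continuous_on_const[of _ 1], of w] by simp
  have "cmod (simplex_integral d s h w) \<le>
    set_lebesgue_integral (Rn_measure d) (open_corner d) (\<lambda>t. cmod (h (s (simplex_chart d t)) * pullback_coeff d s w t))"
    unfolding simplex_integral_def
    by (rule set_integral_norm_bound[OF set_integrable_mult_pullback_coeff[OF s C1 h]])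
  also have "\<dots> \<le> set_lebesgue_integral (Rn_measure d) (open_corner d) (\<lambda>t. cmod (pullback_coeff d s w t) * B)"
  proof (rule set_integral_mono)
    fix t assume "t \<in> open_corner d"
    then have "cmod (h (s (simplex_chart d t))) \<le> B"
      using open_corner_subset_closed_corner simplex_chart_standard_simplex by (intro B) blast
    from mult_right_mono[OF this norm_ge_zero[of "pullback_coeff d s w t"]]
    show "cmod (h (s (simplex_chart d t)) * pullback_coeff d s w t) \<le> cmod (pullback_coeff d s w t) * B"
      by (simp add: norm_mult mult.commute)
  qed (use set_integrable_norm[OF int] set_integrable_norm[OF set_integrable_mult_pullback_coeff[OF s C1 h]] in auto)
  finally show ?thesis by simp
qed

lemma relative_C1_chain_keys:
  assumes "relative_C1_chain d X Y \<sigma>" "s \<in> Poly_Mapping.keys \<sigma>"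
  shows "singular_simplex d (top_of_set X) s" "C1_singular_simplex d s"
  using assms by (auto simp: relative_C1_chain_def singular_relcycle singular_chain_def)

lemma chain_integral_sum:
  fixes h :: "'b \<Rightarrow> complex ^ 'n::finite \<Rightarrow> complex"
  assumes \<sigma>: "relative_C1_chain d X Y \<sigma>"
    and h: "\<And>a. a \<in> A \<Longrightarrow> continuous_on UNIV (h a)"
  shows "chain_integral d \<sigma> (\<lambda>z. \<Sum>a\<in>A. c a * h a z) w = (\<Sum>a\<in>A. c a * chain_integral d \<sigma> (h a) w)"
proof -
  have "chain_integral d \<sigma> (\<lambda>z. \<Sum>a\<in>A. c a * h a z) w =
      (\<Sum>s\<in>Poly_Mapping.keys \<sigma>. of_int (Poly_Mapping.lookup \<sigma> s) * (\<Sum>a\<in>A. c a * simplex_integral d s (h a) w))"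
    unfolding chain_integral_def
    by (intro sum.cong refl arg_cong2[where f = "(*)"] simplex_integral_sum[where X = X]
        relative_C1_chain_keys[OF \<sigma>] h)
  then show ?thesis
    unfolding chain_integral_def sum_distrib_left
    by (subst sum.swap) (simp add: mult_ac)
qed

lemma chain_integral_bound:
  fixes \<sigma> :: "(complex ^ 'n::finite) chain"
  assumes \<sigma>: "relative_C1_chain d X Y \<sigma>"
  obtains V where "V \<ge> 0" and "\<And>h B. continuous_on UNIV h \<Longrightarrow>
    (\<And>z. z \<in> chain_support d \<sigma> \<Longrightarrow> cmod (h z) \<le> B) \<Longrightarrow> cmod (chain_integral d \<sigma> h w) \<le> V * B"
proof
  let ?v = "\<lambda>s. \<bar>of_int (Poly_Mapping.lookup \<sigma> s)\<bar> *
    set_lebesgue_integral (Rn_measure d) (open_corner d) (\<lambda>t. cmod (pullback_coeff d s w t))"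
  show "(\<Sum>s\<in>Poly_Mapping.keys \<sigma>. ?v s) \<ge> 0"
    by (intro sum_nonneg mult_nonneg_nonneg) (auto simp: set_lebesgue_integral_def intro!: integral_nonneg_AE)
  fix h B assume h: "continuous_on UNIV h" and B: "\<And>z. z \<in> chain_support d \<sigma> \<Longrightarrow> cmod (h z) \<le> B"
  have "cmod (of_int (Poly_Mapping.lookup \<sigma> s) * simplex_integral d s h w) \<le> ?v s * B"
    if s: "s \<in> Poly_Mapping.keys \<sigma>" for s
  proof -
    have "cmod (simplex_integral d s h w) \<le>
      set_lebesgue_integral (Rn_measure d) (open_corner d) (\<lambda>t. cmod (pullback_coeff d s w t)) * B"
      by (rule simplex_integral_bound[OF relative_C1_chain_keys[OF \<sigma> s] h B])
         (use s in \<open>auto simp: chain_support_def\<close>)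
    then show ?thesis by (simp add: norm_mult mult.assoc mult_left_mono)
  qed
  then show "cmod (chain_integral d \<sigma> h w) \<le> (\<Sum>s\<in>Poly_Mapping.keys \<sigma>. ?v s) * B"
    unfolding chain_integral_def sum_distrib_right by (rule sum_norm_le)
qed

text \<open>Integration over the chain is taken as the functional \<open>L\<close>. The order of
  quantifiers is the point: \<open>V\<close> is chosen before \<open>N\<close> and
  \<open>F\<close>.\<close>

lemma det_period_matrix_bound:
  fixes \<sigma> :: "(complex ^ 'n::finite) chain"
  assumes \<sigma>: "relative_C1_chain d X Y \<sigma>"
  obtains V where "V \<ge> 0" and "\<And>N F. (\<And>i. continuous_on UNIV (F i)) \<Longrightarrow>
    fact N * cmod (Determinant.det (period_matrix d \<sigma> w N F)) \<le> V ^ N * (t_sup (chain_support d \<sigma>) N F)\<^sup>2"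
proof -
  obtain V where V: "V \<ge> 0" and bound: "\<And>h B. continuous_on UNIV h \<Longrightarrow>
    (\<And>z. z \<in> chain_support d \<sigma> \<Longrightarrow> cmod (h z) \<le> B) \<Longrightarrow> cmod (chain_integral d \<sigma> h w) \<le> V * B"
    using chain_integral_bound[OF \<sigma>] by blast
  have "fact N * cmod (Determinant.det (period_matrix d \<sigma> w N F)) \<le> V ^ N * (t_sup (chain_support d \<sigma>) N F)\<^sup>2"
    if F: "\<And>i. continuous_on UNIV (F i)" for N and F :: "nat \<Rightarrow> complex ^ 'n \<Rightarrow> complex"
    unfolding period_matrix_def
  proof (rule det_bilinear_functional_bound[where K = "chain_support d \<sigma>"])
    have "singular_chain d (top_of_set X) \<sigma>"
      using \<sigma> by (simp add: relative_C1_chain_def singular_relcycle)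
    then have "\<exists>C. \<forall>z\<in>chain_support d \<sigma>. cmod (F i z) \<le> C" for i
      using bounded_continuous_image_chain_support[OF _ F] by metis
    then show "cmod (Determinant.det (Matrix.mat N N (\<lambda>(i, j). F i (z j)))) \<le> t_sup (chain_support d \<sigma>) N F"
      if "\<And>j. j < N \<Longrightarrow> z j \<in> chain_support d \<sigma>" for z
      using that by (intro t_sup_upper)
  qed (use bound F in \<open>auto intro: chain_integral_sum[OF \<sigma>]\<close>)
  with V show ?thesis using that by blast
qed

section \<open>Comparison of the two bounds\<close>

lemma norm_of_rat: "norm (of_rat q :: 'a::{real_normed_field, field_char_0}) = of_rat \<bar>q\<bar>"
  by (cases q) (simp add: of_rat_rat norm_divide)

theorem mainTheorem1:
  fixes X Y :: "(complex ^ 'n::finite) set"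
    and d :: nat
    and \<omega> :: "'n qform"
    and \<sigma> :: "(complex ^ 'n) chain"
    and f :: "'r::finite \<Rightarrow> 'n qpoly"
    and m :: nat
    and \<xi>s :: "nat \<Rightarrow> real"
    and \<xi> :: real
    and S :: "nat set"
    and P :: "nat \<Rightarrow> nat \<Rightarrow> 'r qpoly"
    and Dl Dr :: "nat \<Rightarrow> rat Matrix.mat"
  assumes X: "smooth_affine_variety X d"
    and Y: "divisor_on Y X d"
    and \<sigma>: "relative_C1_chain d X Y \<sigma>"
    and periods: "\<And>k :: 'r \<Rightarrow> nat.
      chain_integral d \<sigma> (\<lambda>z. \<Prod>s\<in>UNIV. regfun (f s) z ^ k s) \<omega>
        \<in> complex_of_real ` rat_combinations m \<xi>s"
    and \<xi>s: "(m = 2 \<and> \<xi>s 1 = 1 \<and> \<xi>s 2 = \<xi>) \<or>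
      (m > 2 \<and> \<xi>s 1 = 1 \<and> (\<forall>i\<in>{2..m}. \<xi>s i \<in> rat_polys_at \<xi>))"
    and S: "infinite S"
    and indep: "\<And>N. N \<in> S \<Longrightarrow> lin_indep_on X N (\<lambda>i. poly_in f (P N i))"
    and det: "\<And>N. N \<in> S \<Longrightarrow>
      Determinant.det (period_matrix d \<sigma> \<omega> N (\<lambda>i. poly_in f (P N i))) \<noteq> 0"
    and GL: "\<And>N. N \<in> S \<Longrightarrow> Dl N \<in> GL_Q N \<and> Dr N \<in> GL_Q N"
    and entries: "\<And>N i j. N \<in> S \<Longrightarrow> i < N \<Longrightarrow> j < N \<Longrightarrow>
      (map_mat of_rat (Dl N) * period_matrix d \<sigma> \<omega> N (\<lambda>i. poly_in f (P N i)) * map_mat of_rat (Dr N)) $$ (i, j)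
        \<in> complex_of_real ` int_combinations m \<xi>s"
    and lim: "((\<lambda>N. (t_sup (chain_support d \<sigma>) N (\<lambda>i. poly_in f (P N i)))\<^sup>2
        * of_rat \<bar>Determinant.det (Dl N * Dr N)\<bar>) \<longlongrightarrow> 0) (inf sequentially (principal S))"
  shows "\<xi> \<notin> \<rat>"
proof
  assume rational: "\<xi> \<in> \<rat>"
  have "\<xi>s i \<in> \<rat>" if "i \<in> {1..m}" for i
  proof (cases "i = 1")
    case True
    then show ?thesis using \<xi>s by auto
  next
    case False
    then have "i \<in> {2..m}" using that by auto
    then show ?thesis using \<xi>s rational rat_polys_at_Rats by (cases "m = 2") auto
  qed
  \<comment> \<open>Both \<open>b\<close> and the \<open>V\<close> obtained next are fixed before
    \<open>N\<close>, so that \<open>(of_nat b * V) ^ N < fact N\<close> can be demanded when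
    \<open>N\<close> is chosen.\<close>
  then obtain b :: nat where b: "b > 0" and b_Ints: "\<And>i. i \<in> {1..m} \<Longrightarrow> of_nat b * \<xi>s i \<in> \<int>"
    using Rats_common_denominator[of "{1..m}" \<xi>s] by blast
  obtain V where V: "V \<ge> 0" and bound: "\<And>N F. (\<And>i. continuous_on UNIV (F i)) \<Longrightarrow>
    fact N * cmod (Determinant.det (period_matrix d \<sigma> \<omega> N F)) \<le> V ^ N * (t_sup (chain_support d \<sigma>) N F)\<^sup>2"
    using det_period_matrix_bound[OF \<sigma>] by blast
  have "\<forall>\<^sub>F N in sequentially. N \<in> S \<longrightarrow>
      (t_sup (chain_support d \<sigma>) N (\<lambda>i. poly_in f (P N i)))\<^sup>2 * of_rat \<bar>Determinant.det (Dl N * Dr N)\<bar> < 1"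
    using order_tendstoD(2)[OF lim, of 1] by (simp add: eventually_inf_principal)
  note ev = eventually_conj[OF this power_eventually_less_fact[of "of_nat b * V"]]
  \<comment> \<open>The limit gives information only along \<open>S\<close>. Since \<open>S\<close>
    is infinite, its members occur beyond every threshold, and one of them meets both eventual
    conditions.\<close>
  have "\<exists>\<^sub>F N in sequentially. N \<in> S"
    using S by (simp add: frequently_cofinite flip: cofinite_eq_sequentially)
  from frequently_ex[OF frequently_eventually_frequently[OF this ev]]
  obtain N where N: "N \<in> S"
    and small: "(t_sup (chain_support d \<sigma>) N (\<lambda>i. poly_in f (P N i)))\<^sup>2 * of_rat \<bar>Determinant.det (Dl N * Dr N)\<bar> < 1"
    and fact: "(of_nat b * V) ^ N < fact N"
    by auto
  define Q where "Q = period_matrix d \<sigma> \<omega> N (\<lambda>i. poly_in f (P N i))"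
  define t where "t = t_sup (chain_support d \<sigma>) N (\<lambda>i. poly_in f (P N i))"
  define M where "M = map_mat of_rat (Dl N) * Q * map_mat of_rat (Dr N)"
  define \<delta> :: real where "\<delta> = of_rat \<bar>Determinant.det (Dl N * Dr N)\<bar>"
  have D: "Dl N \<in> carrier_mat N N" "Dr N \<in> carrier_mat N N"
    "Determinant.det (Dl N) \<noteq> 0" "Determinant.det (Dr N) \<noteq> 0"
    using GL[OF N] invertible_mat_det_nonzero by (auto simp: GL_Q_def)
  have Q: "Q \<in> carrier_mat N N" by (simp add: Q_def period_matrix_def)
  \<comment> \<open>The transformations rescale the determinant by exactly
    \<open>det (Dl N * Dr N)\<close>; this is how \<open>\<delta>\<close> enters both the arithmetic
    and the analytic bound.\<close>
  have detM: "Determinant.det M = of_rat (Determinant.det (Dl N * Dr N)) * Determinant.det Q"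
    using D Q by (simp add: M_def det_mult[of _ N] of_rat_mult)
  have cmod_M: "cmod (Determinant.det M) = \<delta> * cmod (Determinant.det Q)"
    by (simp add: detM \<delta>_def norm_mult norm_of_rat)
  have "of_nat b * M $$ (i, j) \<in> \<int>" if ij: "i < N" "j < N" for i j
  proof -
    obtain y where y: "y \<in> int_combinations m \<xi>s" "M $$ (i, j) = complex_of_real y"
      using entries[OF N ij] by (auto simp: M_def Q_def)
    then have "of_nat b * y \<in> \<int>" using int_combinations_mult_Ints b_Ints by blast
    then obtain k :: int where "of_nat b * y = of_int k" by (elim Ints_cases)
    then have "of_nat b * M $$ (i, j) = of_int k"
      unfolding y(2) by (metis of_real_mult of_real_of_int_eq of_real_of_nat_eq)
    then show ?thesis by simp
  qed
  moreover have "M \<in> carrier_mat N N" using D Q by (simp add: M_def)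
  moreover have "Determinant.det M \<noteq> 0"
    using det[OF N] D by (simp add: detM det_mult[of _ N] Q_def)
  ultimately have "1 \<le> of_nat b ^ N * cmod (Determinant.det M)"
    by (intro cmod_det_ge_of_bounded_denominator b)
  then have "fact N \<le> fact N * (of_nat b ^ N * cmod (Determinant.det M))" by simp
  also have "\<dots> = of_nat b ^ N * \<delta> * (fact N * cmod (Determinant.det Q))"
    by (simp add: cmod_M)
  also have "\<dots> \<le> of_nat b ^ N * \<delta> * (V ^ N * t\<^sup>2)"
    unfolding Q_def t_def by (intro mult_left_mono bound continuous_on_poly_in) (simp add: \<delta>_def)
  also have "\<dots> = (of_nat b * V) ^ N * (t\<^sup>2 * \<delta>)" by (simp add: power_mult_distrib)
  also have "\<dots> \<le> (of_nat b * V) ^ N" using small V by (intro mult_left_le) (auto simp: t_def \<delta>_def)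
  finally show False using fact by simp
qed

end
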